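(* Let $p$ be a prime, $s\in\mathbb{C}$ with $0<|s|<1$, $a\in\mathbb{C}\setminus\{0\}$, and suppose that $\Omega^{(\infty)}_{s,a}:(T_p,\rho_\alpha)\to\mathbb{R}^3$ with $\alpha=1/D_s$ is an L-isometry. Then there exists an L-contraction (Lipschitz map) $J:\mathbb{C}\to\mathbb{R}^3$ such that, for every $l\in\mathbb{Q}_p$, $J$ maps the cluster $B_l^0=\Upsilon^{(\infty)}_s(\{x\in\mathbb{Q}_p:|x-l|_p\le1\})$ isometrically onto the image $\Omega^{(\infty)}_{s,a}\big(\{(\{l\}_p,y):y\in\mathbb{Z}_p\}\big)$ of the fiber over $\{l\}_p$, and $$\Omega^{(\infty)}_{s,a}\circ j=J\circ\Upsilon^{(\infty)}_s .$$
   Context: Each nonzero $x\in\mathbb{Q}_p$ is written uniquely as $x=\sum_{n\ge v(x)}x_np^n$ with $x_n\in\{0,\dots,p-1\}$, $x_{v(x)}\ne0$; set $x_n=0$ for $n<v(x)$, $|x|_p=p^{-v(x)}$. Put $\{x\}_p=\sum_{n<0}x_np^n\in\mathbb{Q}\cap[0,1)$, $[x]_p=\sum_{n\ge0}x_np^n\in\mathbb{Z}_p$, $D_s=-1/\log_p|s|$, and $\chi_n^{(\infty)}(x)=\exp\big(\frac{2\pi i}{p}\sum_{k=0}^\infty x_{n-k}p^{-k}\big)$. Define $$\Upsilon^{(\infty)}_s(x)=\frac{1-s^{v(x)}}{1-s}+\sum_{n=v(x)}^\infty s^n\chi_n^{(\infty)}(x),\qquad \Upsilon^{(\infty)}_s(0)=\frac1{1-s}.$$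 The $p$-adic solenoid is $T_p=(\mathbb{R}\times\mathbb{Z}_p)/\{(n,-n):n\in\mathbb{Z}\}$ with canonical projection $\phi$ and metric $\rho_\alpha(f,g)=\inf\{\max(|\xi-\eta|,|x-y|_p^\alpha):(\xi,x)\in f,\ (\eta,y)\in g\}$. Each element has a unique representative $(\xi,x)\in[0,1)\times\mathbb{Z}_p$ and is denoted by it. The map $j:\mathbb{Q}_p\to T_p$ is $j(x)=(\{x\}_p,[x]_p)$. For $n\ge0$ let $\tilde\chi^{(\infty)}_n(\xi,x)=\exp(2\pi i\xi/p^{n+1})\chi_n^{(\infty)}(x)$ on $\mathbb{R}\times\mathbb{Z}_p$ and $\omega^{(\infty)}_s(\xi,x)=\sum_{n=0}^\infty s^n\tilde\chi_n^{(\infty)}(\xi,x)$; these are constant on cosets of $\{(n,-n)\}$. $\Omega^{(\infty)}_{s,a}:T_p\to\mathbb{R}^3$ sends $\phi(\xi,x)$ to $(x_1,x_2,x_3)$ given, with $z=\omega^{(\infty)}_s(\xi,x)$, by $x_1+ix_3=e^{2\pi i\xi}|a|(1+\operatorname{Re}(z/a))$, $x_2=|a|\operatorname{Im}(z/a)$. A map $\Phi:(M,\rho)\to(N,\rho')$ is an L-contraction if $\rho'(\Phi(u),\Phi(w))\le C\rho(u,w)$ for some constant $C$ and all $u,w$; it is an L-isometry if moreover $\rho(u,w)\le C\rho'(\Phi(u),\Phi(w))$ for some constant $C$ and all $u,w$. $\mathbb{C}$ and $\mathbb{R}^3$ carry Euclidean metrics. *)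

theory Defs
  imports "HOL-Analysis.Analysis" "HOL-Computational_Algebra.Primes"
begin

section \<open>The additive group of p-adic numbers\<close>

text \<open>
  A p-adic number is identified with its digit sequence: \<open>x\<close> stands for the sum of all
  \<open>x n * p ^ n\<close>, where only finitely many negative positions carry a nonzero digit.
\<close>

type_synonym padic = "int \<Rightarrow> int"

definition Qp :: "nat \<Rightarrow> padic set" where
  "Qp p = {x. (\<forall>n. 0 \<le> x n \<and> x n < int p) \<and> (\<exists>N. \<forall>n<N. x n = 0)}"

definition Zp :: "nat \<Rightarrow> padic set" where
  "Zp p = {x \<in> Qp p. \<forall>n<0. x n = 0}"

definition padic_zero :: padic where
  "padic_zero = (\<lambda>_. 0)"

definition padic_trunc :: "nat \<Rightarrow> padic \<Rightarrow> int \<Rightarrow> real" where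
  "padic_trunc p x n = (\<Sum>k | k \<le> n \<and> x k \<noteq> 0. real_of_int (x k) * real p powi k)"

text \<open>
  The coefficient of \<open>p ^ n\<close> in the p-adic expansion of \<open>q \<in> \<int>[1/p]\<close>. It depends
  on \<open>q\<close> only modulo \<open>p ^ (n + 1)\<close>, and the formula is also right for negative \<open>q\<close>:
  for \<open>q = - 1\<close> it gives the digit \<open>p - 1\<close> at every \<open>n \<ge> 0\<close>.
\<close>

definition padic_digit :: "nat \<Rightarrow> real \<Rightarrow> int \<Rightarrow> int" where
  "padic_digit p q n = \<lfloor>q / real p powi n\<rfloor> mod int p"

text \<open>
  Addition and subtraction with carries. Since \<open>x\<close> is congruent to \<open>padic_trunc p x n\<close>
  modulo \<open>p ^ (n + 1)\<close>, the digits up to position \<open>n\<close> of \<open>x\<close> and \<open>y\<close> determine the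
  digit at \<open>n\<close> of the sum and of the difference; see \<open>padic_trunc_add\<close>,
  \<open>padic_trunc_diff\<close> and \<open>padic_eqI\<close> below.
\<close>

definition padic_add :: "nat \<Rightarrow> padic \<Rightarrow> padic \<Rightarrow> padic" where
  "padic_add p x y = (\<lambda>n. padic_digit p (padic_trunc p x n + padic_trunc p y n) n)"

definition padic_diff :: "nat \<Rightarrow> padic \<Rightarrow> padic \<Rightarrow> padic" where
  "padic_diff p x y = (\<lambda>n. padic_digit p (padic_trunc p x n - padic_trunc p y n) n)"

definition padic_of_int :: "nat \<Rightarrow> int \<Rightarrow> padic" where
  "padic_of_int p m = (\<lambda>n. padic_digit p (real_of_int m) n)"

definition padic_val :: "padic \<Rightarrow> int" where
  "padic_val x = (THE n. x n \<noteq> 0 \<and> (\<forall>m<n. x m = 0))"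

definition padic_norm :: "nat \<Rightarrow> padic \<Rightarrow> real" where
  "padic_norm p x = (if x = padic_zero then 0 else real p powi (- padic_val x))"

definition padic_frac :: "nat \<Rightarrow> padic \<Rightarrow> real" where
  "padic_frac p x = (\<Sum>n | n < 0 \<and> x n \<noteq> 0. real_of_int (x n) * real p powi n)"

definition padic_int_part :: "padic \<Rightarrow> padic" where
  "padic_int_part x = (\<lambda>n. if 0 \<le> n then x n else 0)"


section \<open>The maps into the complex plane\<close>

definition Ds :: "nat \<Rightarrow> complex \<Rightarrow> real" where
  "Ds p s = - 1 / log (real p) (cmod s)"

definition chi :: "nat \<Rightarrow> int \<Rightarrow> padic \<Rightarrow> complex" where
  "chi p n x = exp (2 * of_real pi * \<i> / of_nat p *
     of_real (\<Sum>k. real_of_int (x (n - int k)) * real p powi (- int k)))"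

definition Upsilon :: "nat \<Rightarrow> complex \<Rightarrow> padic \<Rightarrow> complex" where
  "Upsilon p s x =
     (if x = padic_zero then 1 / (1 - s)
      else (1 - s powi padic_val x) / (1 - s) +
           (\<Sum>k. s powi (padic_val x + int k) * chi p (padic_val x + int k) x))"

definition cluster :: "nat \<Rightarrow> complex \<Rightarrow> padic \<Rightarrow> complex set" where
  "cluster p s l = Upsilon p s ` {x \<in> Qp p. padic_norm p (padic_diff p x l) \<le> 1}"


section \<open>The solenoid and its embedding into space\<close>

definition solenoid_proj :: "nat \<Rightarrow> real \<times> padic \<Rightarrow> (real \<times> padic) set" where
  "solenoid_proj p = (\<lambda>(\<xi>, x). {(\<xi> + real_of_int n, padic_add p x (padic_of_int p (- n))) | n. True})"

definition solenoid :: "nat \<Rightarrow> (real \<times> padic) set set" where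
  "solenoid p = solenoid_proj p ` (UNIV \<times> Zp p)"

definition solenoid_dist ::
    "nat \<Rightarrow> real \<Rightarrow> (real \<times> padic) set \<Rightarrow> (real \<times> padic) set \<Rightarrow> real" where
  "solenoid_dist p \<alpha> f g =
     Inf {max \<bar>\<xi> - \<eta>\<bar> (padic_norm p (padic_diff p x y) powr \<alpha>) | \<xi> x \<eta> y.
          (\<xi>, x) \<in> f \<and> (\<eta>, y) \<in> g}"

definition solenoid_j :: "nat \<Rightarrow> padic \<Rightarrow> (real \<times> padic) set" where
  "solenoid_j p x = solenoid_proj p (padic_frac p x, padic_int_part x)"

definition solenoid_fiber :: "nat \<Rightarrow> real \<Rightarrow> (real \<times> padic) set set" where
  "solenoid_fiber p \<xi> = {solenoid_proj p (\<xi>, y) | y. y \<in> Zp p}"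

definition chi_tilde :: "nat \<Rightarrow> nat \<Rightarrow> real \<times> padic \<Rightarrow> complex" where
  "chi_tilde p n = (\<lambda>(\<xi>, x). exp (2 * of_real pi * \<i> * of_real \<xi> / of_nat p ^ (n + 1)) * chi p (int n) x)"

definition omega :: "nat \<Rightarrow> complex \<Rightarrow> real \<times> padic \<Rightarrow> complex" where
  "omega p s u = (\<Sum>n. s ^ n * chi_tilde p n u)"

definition Omega_rep :: "nat \<Rightarrow> complex \<Rightarrow> complex \<Rightarrow> real \<times> padic \<Rightarrow> real ^ 3" where
  "Omega_rep p s a u =
     (let z = omega p s u;
          w = exp (2 * of_real pi * \<i> * of_real (fst u)) * of_real (cmod a * (1 + Re (z / a)))
      in vector [Re w, cmod a * Im (z / a), Im w])"

text \<open>
  \<open>Omega_rep\<close> is constant on each coset, so its image of a coset is a singleton; see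
  \<open>Omega_solenoid_proj\<close> below.
\<close>

definition Omega :: "nat \<Rightarrow> complex \<Rightarrow> complex \<Rightarrow> (real \<times> padic) set \<Rightarrow> real ^ 3" where
  "Omega p s a f = the_elem (Omega_rep p s a ` f)"


section \<open>Lipschitz notions\<close>

definition L_contraction_on ::
    "'a set \<Rightarrow> ('a \<Rightarrow> 'a \<Rightarrow> real) \<Rightarrow> ('b \<Rightarrow> 'b \<Rightarrow> real) \<Rightarrow> ('a \<Rightarrow> 'b) \<Rightarrow> bool" where
  "L_contraction_on M \<rho> \<rho>' \<Phi> \<longleftrightarrow> (\<exists>C. \<forall>u\<in>M. \<forall>w\<in>M. \<rho>' (\<Phi> u) (\<Phi> w) \<le> C * \<rho> u w)"

definition L_isometry_on ::
    "'a set \<Rightarrow> ('a \<Rightarrow> 'a \<Rightarrow> real) \<Rightarrow> ('b \<Rightarrow> 'b \<Rightarrow> real) \<Rightarrow> ('a \<Rightarrow> 'b) \<Rightarrow> bool" where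
  "L_isometry_on M \<rho> \<rho>' \<Phi> \<longleftrightarrow>
     L_contraction_on M \<rho> \<rho>' \<Phi> \<and> (\<exists>C. \<forall>u\<in>M. \<forall>w\<in>M. \<rho> u w \<le> C * \<rho>' (\<Phi> u) (\<Phi> w))"


section \<open>Correctness of the arithmetic on digit sequences\<close>

definition padic_cong :: "nat \<Rightarrow> int \<Rightarrow> real \<Rightarrow> real \<Rightarrow> bool" where
  "padic_cong p n q r \<longleftrightarrow> (\<exists>m::int. q - r = real_of_int m * real p powi n)"

lemma padic_cong_trans: "padic_cong p n q r \<Longrightarrow> padic_cong p n r t \<Longrightarrow> padic_cong p n q t"
  unfolding padic_cong_def
proof (elim exE)
  fix m m' :: int
  assume "q - r = real_of_int m * real p powi n" "r - t = real_of_int m' * real p powi n"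
  then show "\<exists>m. q - t = real_of_int m * real p powi n"
    by (intro exI[of _ "m + m'"]) (simp add: algebra_simps)
qed

lemma padic_cong_sym: "padic_cong p n q r \<Longrightarrow> padic_cong p n r q"
  unfolding padic_cong_def
proof (elim exE)
  fix m :: int
  assume "q - r = real_of_int m * real p powi n"
  then show "\<exists>m. r - q = real_of_int m * real p powi n"
    by (intro exI[of _ "- m"]) (simp add: algebra_simps)
qed

lemma padic_cong_add:
  "padic_cong p n q r \<Longrightarrow> padic_cong p n q' r' \<Longrightarrow> padic_cong p n (q + q') (r + r')"
  unfolding padic_cong_def
proof (elim exE)
  fix m m' :: int
  assume "q - r = real_of_int m * real p powi n" "q' - r' = real_of_int m' * real p powi n"
  then show "\<exists>m. q + q' - (r + r') = real_of_int m * real p powi n"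
    by (intro exI[of _ "m + m'"]) (simp add: algebra_simps)
qed

lemma padic_trunc_eq_0: "(\<forall>k\<le>n. x k = 0) \<Longrightarrow> padic_trunc p x n = 0"
  unfolding padic_trunc_def by (intro sum.neutral) auto

lemma padic_support_finite:
  assumes "x \<in> Qp p"
  shows "finite {k. k \<le> n \<and> x k \<noteq> 0}"
proof -
  obtain N where N: "\<forall>k<N. x k = 0"
    using assms by (auto simp: Qp_def)
  have "{k. k \<le> n \<and> x k \<noteq> 0} \<subseteq> {N..n}"
    using N by (auto simp: not_less[symmetric])
  then show ?thesis
    using finite_subset by blast
qed

lemma padic_trunc_step:
  assumes "x \<in> Qp p"
  shows "padic_trunc p x n = padic_trunc p x (n - 1) + real_of_int (x n) * real p powi n"
proof (cases "x n = 0")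
  case True
  then have "{k. k \<le> n \<and> x k \<noteq> 0} = {k. k \<le> n - 1 \<and> x k \<noteq> 0}"
    by (auto simp: order_le_less)
  then show ?thesis
    using True by (simp add: padic_trunc_def)
next
  case False
  then have "{k. k \<le> n \<and> x k \<noteq> 0} = insert n {k. k \<le> n - 1 \<and> x k \<noteq> 0}"
    by auto
  then show ?thesis
    using padic_support_finite[OF assms, of "n - 1"] by (simp add: padic_trunc_def)
qed

lemma padic_trunc_bounds:
  assumes "x \<in> Qp p" "p > 1"
  shows "0 \<le> padic_trunc p x n" "padic_trunc p x n < real p powi (n + 1)"
proof -
  obtain N where N: "\<forall>k<N. x k = 0"
    using assms by (auto simp: Qp_def)
  have "0 \<le> padic_trunc p x n \<and> padic_trunc p x n < real p powi (n + 1)"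
  proof (cases "n < N")
    case True
    then have "padic_trunc p x n = 0"
      using N by (intro padic_trunc_eq_0) auto
    then show ?thesis
      using assms by simp
  next
    case False
    then have "N - 1 \<le> n"
      by simp
    then show ?thesis
    proof (induction n rule: int_ge_induct)
      case base
      have "padic_trunc p x (N - 1) = 0"
        using N by (intro padic_trunc_eq_0) auto
      then show ?case
        using assms by simp
    next
      case (step i)
      have d: "0 \<le> x (i + 1)" "x (i + 1) \<le> int p - 1"
        using assms by (auto simp: Qp_def)
      have pos: "0 < real p powi (i + 1)"
        using assms by simp
      have "real_of_int (x (i + 1)) \<le> real p - 1"
        using d(2) by linarith
      then have "real_of_int (x (i + 1)) * real p powi (i + 1) \<le> (real p - 1) * real p powi (i + 1)"
        using pos by (intro mult_right_mono) auto
      moreover have "real p powi (i + 1 + 1) = real p * real p powi (i + 1)"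
        using assms power_int_add_1'[of "real p" "i + 1"] by simp
      moreover have "0 \<le> real_of_int (x (i + 1)) * real p powi (i + 1)"
        using d pos by simp
      ultimately show ?case
        using step.IH padic_trunc_step[OF assms(1), of "i + 1"] by (simp add: algebra_simps)
    qed
  qed
  then show "0 \<le> padic_trunc p x n" "padic_trunc p x n < real p powi (n + 1)"
    by auto
qed

lemma padic_digit_sequence:
  fixes q :: "int \<Rightarrow> real"
  assumes p: "p > 1"
    and small: "\<And>n. n < N \<Longrightarrow> padic_cong p (n + 1) (q n) 0"
    and step: "\<And>n. padic_cong p n (q n) (q (n - 1))"
  defines "z \<equiv> \<lambda>n. padic_digit p (q n) n"
  shows "z \<in> Qp p" "padic_cong p (n + 1) (padic_trunc p z n) (q n)" "\<And>n. n < N \<Longrightarrow> z n = 0"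
proof -
  have z0: "z n = 0" if n: "n < N" for n
  proof -
    obtain m :: int where "q n = real_of_int m * real p powi (n + 1)"
      using small[OF n] by (auto simp: padic_cong_def)
    then have "q n / real p powi n = real_of_int (m * int p)"
      using p by (simp add: power_int_add)
    then have "\<lfloor>q n / real p powi n\<rfloor> = m * int p"
      by (metis floor_of_int)
    then show ?thesis
      by (simp add: z_def padic_digit_def)
  qed
  then show "\<And>n. n < N \<Longrightarrow> z n = 0" .
  show zQ: "z \<in> Qp p"
    using z0 p by (auto simp: Qp_def z_def padic_digit_def)
  show "padic_cong p (n + 1) (padic_trunc p z n) (q n)"
  proof (cases "n < N")
    case True
    then have "padic_trunc p z n = 0"
      using z0 by (intro padic_trunc_eq_0) auto
    then show ?thesis
      using small[OF True] padic_cong_sym by metis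
  next
    case False
    then have "N - 1 \<le> n"
      by simp
    then show ?thesis
    proof (induction n rule: int_ge_induct)
      case base
      have "padic_trunc p z (N - 1) = 0"
        using z0 by (intro padic_trunc_eq_0) auto
      then show ?case
        using small[of "N - 1"] padic_cong_sym by simp
    next
      case (step i)
      define n where "n = i + 1"
      let ?P = "real p powi n"
      have P: "?P > 0"
        using p by simp
      obtain m :: int where m: "padic_trunc p z (n - 1) - q (n - 1) = real_of_int m * ?P"
        using step.IH by (auto simp: n_def padic_cong_def)
      obtain k :: int where k: "q n - q (n - 1) = real_of_int k * ?P"
        using assms(3)[of n] by (auto simp: padic_cong_def)
      have t: "0 \<le> padic_trunc p z (n - 1)" "padic_trunc p z (n - 1) < ?P"
        using padic_trunc_bounds[OF zQ p, of "n - 1"] by auto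
      have "q n = padic_trunc p z (n - 1) + real_of_int (k - m) * ?P"
        using m k by (simp add: algebra_simps)
      then have "q n / ?P = padic_trunc p z (n - 1) / ?P + real_of_int (k - m)"
        using p by (simp add: add_divide_distrib)
      moreover have "0 \<le> padic_trunc p z (n - 1) / ?P" "padic_trunc p z (n - 1) / ?P < 1"
        using t P by simp_all
      ultimately have "\<lfloor>q n / ?P\<rfloor> = k - m"
        by linarith
      then have "z n = (k - m) mod int p"
        by (simp add: z_def padic_digit_def)
      then obtain c where c: "z n = k - m + int p * c"
        by (metis mod_eqE mod_mod_trivial)
      have "padic_trunc p z n - q n = real_of_int (m - k + z n) * ?P"
        using m k padic_trunc_step[OF zQ, of n] by (simp add: algebra_simps)
      also have "\<dots> = real_of_int c * real p powi (n + 1)"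
        using c p by (simp add: power_int_add)
      finally show ?case
        by (auto simp: n_def padic_cong_def)
    qed
  qed
qed

lemma padic_trunc_cong_step:
  assumes "x \<in> Qp p"
  shows "padic_cong p n (padic_trunc p x n) (padic_trunc p x (n - 1))"
  using padic_trunc_step[OF assms, of n] by (auto simp: padic_cong_def)

lemma padic_Qp2_bound:
  assumes "x \<in> Qp p" "y \<in> Qp p"
  obtains N where "\<And>n. n < N \<Longrightarrow> padic_trunc p x n = 0" "\<And>n. n < N \<Longrightarrow> padic_trunc p y n = 0"
proof -
  obtain N M where N: "\<forall>n<N. x n = 0" and M: "\<forall>n<M. y n = 0"
    using assms by (auto simp: Qp_def)
  show thesis
    by (rule that[of "min N M"]; rule padic_trunc_eq_0; use N M in auto)
qed

lemma
  assumes "x \<in> Qp p" "y \<in> Qp p" "p > 1"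
  shows padic_add_closed: "padic_add p x y \<in> Qp p"
    and padic_trunc_add: "padic_cong p (n + 1) (padic_trunc p (padic_add p x y) n)
           (padic_trunc p x n + padic_trunc p y n)"
proof -
  obtain N where N: "\<And>n. n < N \<Longrightarrow> padic_trunc p x n = 0" "\<And>n. n < N \<Longrightarrow> padic_trunc p y n = 0"
    using padic_Qp2_bound assms by blast
  let ?q = "\<lambda>n. padic_trunc p x n + padic_trunc p y n"
  have 1: "padic_cong p (n + 1) (?q n) 0" if "n < N" for n
    using N[OF that] by (auto simp: padic_cong_def)
  have 2: "padic_cong p n (?q n) (?q (n - 1))" for n
    using assms by (intro padic_cong_add padic_trunc_cong_step)
  show "padic_add p x y \<in> Qp p"
    unfolding padic_add_def by (rule padic_digit_sequence(1)[where q = ?q, OF assms(3) 1 2])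
  show "padic_cong p (n + 1) (padic_trunc p (padic_add p x y) n) (?q n)"
    unfolding padic_add_def by (rule padic_digit_sequence(2)[where q = ?q, OF assms(3) 1 2])
qed

lemma
  assumes "x \<in> Qp p" "y \<in> Qp p" "p > 1"
  shows padic_diff_closed: "padic_diff p x y \<in> Qp p"
    and padic_trunc_diff: "padic_cong p (n + 1) (padic_trunc p (padic_diff p x y) n)
           (padic_trunc p x n - padic_trunc p y n)"
proof -
  obtain N where N: "\<And>n. n < N \<Longrightarrow> padic_trunc p x n = 0" "\<And>n. n < N \<Longrightarrow> padic_trunc p y n = 0"
    using padic_Qp2_bound assms by blast
  let ?q = "\<lambda>n. padic_trunc p x n - padic_trunc p y n"
  have 1: "padic_cong p (n + 1) (?q n) 0" if "n < N" for n
    using N[OF that] by (auto simp: padic_cong_def)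
  have 2: "padic_cong p n (?q n) (?q (n - 1))" for n
    using padic_trunc_step[OF assms(1), of n] padic_trunc_step[OF assms(2), of n]
    unfolding padic_cong_def by (intro exI[of _ "x n - y n"]) (simp add: algebra_simps)
  show "padic_diff p x y \<in> Qp p"
    unfolding padic_diff_def by (rule padic_digit_sequence(1)[where q = ?q, OF assms(3) 1 2])
  show "padic_cong p (n + 1) (padic_trunc p (padic_diff p x y) n) (?q n)"
    unfolding padic_diff_def by (rule padic_digit_sequence(2)[where q = ?q, OF assms(3) 1 2])
qed

lemma
  assumes "p > 1"
  shows padic_of_int_Zp: "padic_of_int p m \<in> Zp p"
    and padic_trunc_of_int: "padic_cong p (n + 1) (padic_trunc p (padic_of_int p m) n) (real_of_int m)"
proof -
  let ?q = "\<lambda>n::int. real_of_int m"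
  have 1: "padic_cong p (n + 1) (?q n) 0" if "n < 0" for n
  proof -
    obtain j :: nat where "n + 1 = - int j"
      using \<open>n < 0\<close> nonpos_int_cases[of "n + 1"] by auto
    then have "real_of_int m = real_of_int (m * int p ^ j) * real p powi (n + 1)"
      using assms by (simp add: power_int_minus)
    then show ?thesis
      unfolding padic_cong_def by (metis diff_zero)
  qed
  have 2: "padic_cong p n (?q n) (?q (n - 1))" for n
    by (auto simp: padic_cong_def)
  show "padic_of_int p m \<in> Zp p"
    unfolding padic_of_int_def Zp_def
    using padic_digit_sequence(1)[where q = ?q, OF assms 1 2]
      padic_digit_sequence(3)[where q = ?q, OF assms 1 2] by simp
  show "padic_cong p (n + 1) (padic_trunc p (padic_of_int p m) n) (real_of_int m)"
    unfolding padic_of_int_def by (rule padic_digit_sequence(2)[where q = ?q, OF assms 1 2])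
qed

lemma padic_eqI:
  assumes "x \<in> Qp p" "y \<in> Qp p" "p > 1"
    and cong: "\<And>n. padic_cong p (n + 1) (padic_trunc p x n) (padic_trunc p y n)"
  shows "x = y"
proof -
  have t: "padic_trunc p x n = padic_trunc p y n" for n
  proof -
    let ?P = "real p powi (n + 1)"
    obtain m :: int where m: "padic_trunc p x n - padic_trunc p y n = real_of_int m * ?P"
      using cong by (auto simp: padic_cong_def)
    have P: "?P > 0"
      using assms by simp
    have "\<bar>real_of_int m * ?P\<bar> < 1 * ?P"
      using padic_trunc_bounds[OF assms(1,3), of n] padic_trunc_bounds[OF assms(2,3), of n]
      by (simp add: m[symmetric])
    then have "\<bar>real_of_int m\<bar> * ?P < 1 * ?P"
      using P by (simp add: abs_mult)
    then have "\<bar>real_of_int m\<bar> < 1"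
      using P by (simp only: mult_less_cancel_right_pos)
    then have "m = 0"
      by linarith
    then show ?thesis
      using m by simp
  qed
  show ?thesis
  proof
    fix n
    have "real_of_int (x n) * real p powi n = real_of_int (y n) * real p powi n"
      using t[of n] t[of "n - 1"] padic_trunc_step[OF assms(1), of n]
        padic_trunc_step[OF assms(2), of n] by simp
    then show "x n = y n"
      using assms(3) by simp
  qed
qed

lemma padic_diff_add_cancel:
  assumes "x \<in> Qp p" "y \<in> Qp p" "p > 1"
  shows "padic_add p (padic_diff p x y) y = x"
proof (rule padic_eqI[OF _ assms(1,3)])
  note d = padic_diff_closed[OF assms]
  show "padic_add p (padic_diff p x y) y \<in> Qp p"
    by (rule padic_add_closed[OF d assms(2,3)])
  fix n
  have "padic_cong p (n + 1) (padic_trunc p (padic_diff p x y) n + padic_trunc p y n)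
          (padic_trunc p x n - padic_trunc p y n + padic_trunc p y n)"
    by (intro padic_cong_add padic_trunc_diff assms) (auto simp: padic_cong_def)
  then show "padic_cong p (n + 1) (padic_trunc p (padic_add p (padic_diff p x y) y) n) (padic_trunc p x n)"
    using padic_cong_trans[OF padic_trunc_add[OF d assms(2,3)]] by simp
qed

lemma padic_add_assoc:
  assumes "x \<in> Qp p" "y \<in> Qp p" "z \<in> Qp p" "p > 1"
  shows "padic_add p (padic_add p x y) z = padic_add p x (padic_add p y z)"
proof (rule padic_eqI[OF _ _ assms(4)])
  note c = padic_add_closed[OF _ _ assms(4)]
  have xy: "padic_add p x y \<in> Qp p" and yz: "padic_add p y z \<in> Qp p"
    using c assms by auto
  show "padic_add p (padic_add p x y) z \<in> Qp p" "padic_add p x (padic_add p y z) \<in> Qp p"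
    using c xy yz assms by auto
  fix n
  let ?T = "\<lambda>x. padic_trunc p x n"
  have r: "padic_cong p (n + 1) q q" for q
    by (auto simp: padic_cong_def)
  have "padic_cong p (n + 1) (?T (padic_add p (padic_add p x y) z)) (?T x + ?T y + ?T z)"
    using padic_cong_trans[OF padic_trunc_add[OF xy assms(3,4)]
        padic_cong_add[OF padic_trunc_add[OF assms(1,2,4)] r]] .
  moreover have "padic_cong p (n + 1) (?T (padic_add p x (padic_add p y z))) (?T x + (?T y + ?T z))"
    using padic_cong_trans[OF padic_trunc_add[OF assms(1) yz assms(4)]
        padic_cong_add[OF r padic_trunc_add[OF assms(2,3,4)]]] .
  ultimately show "padic_cong p (n + 1) (?T (padic_add p (padic_add p x y) z))
      (?T (padic_add p x (padic_add p y z)))"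
    using padic_cong_trans padic_cong_sym by (metis add.assoc)
qed

lemma padic_add_commute: "padic_add p x y = padic_add p y x"
  by (simp add: padic_add_def add.commute)


section \<open>The map on the solenoid is well defined\<close>

lemma chi_eq_trunc:
  assumes "x \<in> Qp p" "p > 1"
  shows "chi p n x = exp (2 * of_real pi * \<i> * of_real (padic_trunc p x n / real p powi (n + 1)))"
proof -
  let ?f = "\<lambda>k::nat. real_of_int (x (n - int k)) * real p powi (- int k)"
  let ?K = "(\<lambda>j. nat (n - j)) ` {j. j \<le> n \<and> x j \<noteq> 0}"
  have "?f k = 0" if "k \<notin> ?K" for k
  proof (rule ccontr)
    assume "?f k \<noteq> 0"
    then have "n - int k \<in> {j. j \<le> n \<and> x j \<noteq> 0}"
      by auto
    then have "nat (n - (n - int k)) \<in> ?K"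
      by blast
    then show False
      using that by simp
  qed
  then have "suminf ?f = sum ?f ?K"
    using padic_support_finite[OF assms(1)] by (intro suminf_finite) auto
  also have "\<dots> = (\<Sum>j | j \<le> n \<and> x j \<noteq> 0. ?f (nat (n - j)))"
    by (subst sum.reindex) (auto simp: inj_on_def)
  also have "\<dots> = (\<Sum>j | j \<le> n \<and> x j \<noteq> 0. real_of_int (x j) * real p powi j / real p powi n)"
    using assms by (intro sum.cong refl) (auto simp: power_int_diff)
  also have "\<dots> = padic_trunc p x n / real p powi n"
    by (simp add: padic_trunc_def sum_divide_distrib)
  finally have s: "suminf ?f = padic_trunc p x n / real p powi n" .
  show ?thesis
    unfolding chi_def s using assms by (simp add: power_int_add field_simps)
qed

lemma chi_tilde_coset:
  assumes "x \<in> Zp p" "p > 1"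
  shows "chi_tilde p n (\<xi> + real_of_int m, padic_add p x (padic_of_int p (- m))) = chi_tilde p n (\<xi>, x)"
proof -
  let ?y = "padic_add p x (padic_of_int p (- m))"
  let ?P = "real p powi (int n + 1)"
  have P: "?P > 0" and PP: "real p ^ (n + 1) = ?P"
    using assms by (simp_all add: power_int_add)
  have x: "x \<in> Qp p" and i: "padic_of_int p (- m) \<in> Qp p"
    using assms padic_of_int_Zp by (auto simp: Zp_def)
  have y: "?y \<in> Qp p"
    by (rule padic_add_closed[OF x i assms(2)])
  have e: "chi_tilde p n (\<zeta>, z) = exp (2 * of_real pi * \<i> * of_real ((\<zeta> + padic_trunc p z (int n)) / ?P))"
    if "z \<in> Qp p" for \<zeta> z
    unfolding chi_tilde_def prod.case chi_eq_trunc[OF that assms(2)] PP[symmetric]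
    by (subst exp_add[symmetric]) (simp add: add_divide_distrib ring_distribs)
  have "padic_cong p (int n + 1) (padic_trunc p ?y n) (padic_trunc p x n + real_of_int (- m))"
    by (rule padic_cong_trans[OF padic_trunc_add[OF x i assms(2)]])
      (intro padic_cong_add padic_trunc_of_int assms, auto simp: padic_cong_def)
  then obtain c :: int where "padic_trunc p ?y n = padic_trunc p x n - real_of_int m + real_of_int c * ?P"
    by (auto simp: padic_cong_def algebra_simps)
  then have "(\<xi> + real_of_int m + padic_trunc p ?y n) / ?P = (\<xi> + padic_trunc p x n) / ?P + real_of_int c"
    using assms(2) by (simp add: add_divide_distrib diff_divide_distrib)
  moreover have "exp (2 * of_real pi * \<i> * of_real (t + real_of_int c)) = exp (2 * of_real pi * \<i> * of_real t)" for t
    unfolding exp_eq by (intro exI[of _ c]) (simp add: algebra_simps)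
  ultimately show ?thesis
    unfolding e[OF x] e[OF y] by (simp only:)
qed

lemma Omega_solenoid_proj:
  assumes "x \<in> Zp p" "p > 1"
  shows "Omega p s a (solenoid_proj p (\<xi>, x)) = Omega_rep p s a (\<xi>, x)"
proof -
  have "Omega_rep p s a (\<xi> + real_of_int m, padic_add p x (padic_of_int p (- m))) =
      Omega_rep p s a (\<xi>, x)" for m
  proof -
    have "exp (2 * of_real pi * \<i> * of_real (\<xi> + real_of_int m)) = exp (2 * of_real pi * \<i> * of_real \<xi>)"
      unfolding exp_eq by (intro exI[of _ m]) (simp add: algebra_simps)
    then show ?thesis
      by (simp add: Omega_rep_def omega_def chi_tilde_coset[OF assms])
  qed
  then have "Omega_rep p s a u = Omega_rep p s a (\<xi>, x)" if "u \<in> solenoid_proj p (\<xi>, x)" for u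
    using that by (force simp: solenoid_proj_def)
  moreover have "solenoid_proj p (\<xi>, x) \<noteq> {}"
    unfolding solenoid_proj_def by blast
  ultimately have "Omega_rep p s a ` solenoid_proj p (\<xi>, x) = {Omega_rep p s a (\<xi>, x)}"
    by (auto simp: image_iff)
  then show ?thesis
    by (simp add: Omega_def)
qed

end

theory Submission
  imports Defs
begin

text \<open>
  Why the theorem is true. The image of \<open>j\<close> in the solenoid is cut into fibres, and the image of
  \<open>Upsilon\<close> in the plane is cut into clusters, according to the digits of a p-adic number at negative
  positions. While these digits are fixed, \<open>Upsilon\<close> and \<open>omega \<circ> j\<close> differ by a constant
  (\<open>Upsilon_minus_omega\<close>), and \<open>Omega\<close> is \<open>omega\<close> followed by an isometric embedding of the complex
  plane as one page of a book (\<open>dist_page\<close>). So on a single cluster the map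
  \<open>Upsilon x \<mapsto> Omega (j x)\<close> is an isometry onto the image of a fibre (\<open>dist_Omega_j_same_frac\<close>).

  It remains to see that distinct clusters do not come so close that these isometries fail to
  fit together to a Lipschitz map. The hypothesis on \<open>Omega\<close>, read on the fibre over 0, says that
  \<open>Upsilon\<close> does not contract distances of p-adic integers by more than a constant factor. Since
  multiplication by \<open>p\<close> becomes the similarity \<open>z \<mapsto> s * z + 1\<close> of the plane (\<open>Upsilon_shift\<close>),
  the same bound holds on all p-adic numbers (\<open>Upsilon_separates\<close>). Distinct clusters therefore keep
  a fixed positive distance, and as the image of \<open>Omega\<close> is bounded, \<open>Upsilon x \<mapsto> Omega (j x)\<close>
  is well defined and Lipschitz on the whole image of \<open>Upsilon\<close>
  (\<open>Omega_j_Lipschitz_in_Upsilon\<close>). McShane's extension of its three coordinates gives \<open>J\<close>.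
\<close>


section \<open>Extending Lipschitz maps\<close>

text \<open>
  McShane's construction: the extension is the lower envelope \<open>g x = inf {f w + L * dist x w | w \<in> A}\<close>
  of the steepest cones over the graph of \<open>f\<close>.
\<close>

lemma lipschitz_extension_real:
  fixes f :: "'a::metric_space \<Rightarrow> real"
  assumes lip: "\<And>x y. x \<in> A \<Longrightarrow> y \<in> A \<Longrightarrow> \<bar>f x - f y\<bar> \<le> L * dist x y" and L: "0 \<le> L"
  shows "\<exists>g. (\<forall>x\<in>A. g x = f x) \<and> (\<forall>x y. \<bar>g x - g y\<bar> \<le> L * dist x y)"
proof (cases "A = {}")
  case True
  then show ?thesis
    using L by (intro exI[of _ "\<lambda>_. 0"]) simp
next
  case False
  then obtain a where a: "a \<in> A"
    by blast
  define V where "V x = (\<lambda>w. f w + L * dist x w) ` A" for x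
  have ne: "V x \<noteq> {}" for x
    using False by (simp add: V_def)
  have L_triangle: "L * dist x z \<le> L * dist x y + L * dist y z" for x y z
    using mult_left_mono[OF dist_triangle L, of x z y] by (simp add: ring_distribs)
  have bdd: "bdd_below (V x)" for x
  proof (rule bdd_belowI)
    fix t assume "t \<in> V x"
    then obtain w where w: "w \<in> A" "t = f w + L * dist x w"
      by (auto simp: V_def)
    show "f a - L * dist a x \<le> t"
      using lip[OF a w(1)] L_triangle[of a w x] w(2) by linarith
  qed
  have half: "Inf (V x) \<le> Inf (V y) + L * dist x y" for x y
  proof -
    have "Inf (V x) - L * dist x y \<le> t" if "t \<in> V y" for t
    proof -
      obtain w where w: "w \<in> A" "t = f w + L * dist y w"
        using \<open>t \<in> V y\<close> by (auto simp: V_def)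
      have "Inf (V x) \<le> f w + L * dist x w"
        by (rule cInf_lower[OF _ bdd]) (use w in \<open>auto simp: V_def\<close>)
      then show ?thesis
        using L_triangle[of x w y] w(2) by linarith
    qed
    then have "Inf (V x) - L * dist x y \<le> Inf (V y)"
      by (intro cInf_greatest ne)
    then show ?thesis
      by simp
  qed
  have "Inf (V x) = f x" if x: "x \<in> A" for x
  proof (rule cInf_eq_minimum)
    show "f x \<in> V x"
      using x by (auto simp: V_def intro!: image_eqI[of _ _ x])
    show "f x \<le> t" if "t \<in> V x" for t
      using that lip[OF x] by (force simp: V_def)
  qed
  moreover have "\<bar>Inf (V x) - Inf (V y)\<bar> \<le> L * dist x y" for x y
    using half[of x y] half[of y x] by (simp add: dist_commute abs_le_iff)
  ultimately show ?thesis
    by (intro exI[of _ "\<lambda>x. Inf (V x)"]) blast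
qed

text \<open>
  Extending each coordinate separately loses a factor in the constant; that is harmless where only
  the existence of some constant matters.
\<close>

lemma lipschitz_extension_cart:
  fixes f :: "'a::metric_space \<Rightarrow> real ^ 'n"
  assumes lip: "\<And>x y. x \<in> A \<Longrightarrow> y \<in> A \<Longrightarrow> dist (f x) (f y) \<le> L * dist x y" and L: "0 \<le> L"
  shows "\<exists>g. (\<forall>x\<in>A. g x = f x) \<and> (\<forall>x y. dist (g x) (g y) \<le> real CARD('n) * L * dist x y)"
proof -
  have "\<exists>g. (\<forall>x\<in>A. g x = f x $ i) \<and> (\<forall>x y. \<bar>g x - g y\<bar> \<le> L * dist x y)" for i
  proof (rule lipschitz_extension_real[OF _ L])
    show "\<bar>f x $ i - f y $ i\<bar> \<le> L * dist x y" if "x \<in> A" "y \<in> A" for x y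
      using dist_vec_nth_le[of "f x" i "f y"] lip[OF that] by (simp add: dist_real_def)
  qed
  then obtain g where g: "\<And>i x. x \<in> A \<Longrightarrow> g i x = f x $ i"
      "\<And>i x y. \<bar>g i x - g i y\<bar> \<le> L * dist x y"
    by metis
  define h where "h x = (\<chi> i. g i x)" for x
  have "dist (h x) (h y) \<le> real CARD('n) * L * dist x y" for x y
  proof -
    have "dist (h x) (h y) \<le> (\<Sum>i\<in>UNIV. \<bar>(h x - h y) $ i\<bar>)"
      unfolding dist_norm by (rule norm_le_l1_cart)
    also have "\<dots> \<le> (\<Sum>i\<in>(UNIV::'n set). L * dist x y)"
      by (intro sum_mono) (simp add: h_def g(2))
    finally show ?thesis
      by simp
  qed
  moreover have "h x = f x" if "x \<in> A" for x
    using g(1)[OF that] by (simp add: h_def vec_eq_iff)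
  ultimately show ?thesis
    by blast
qed


section \<open>The pages of the book\<close>

text \<open>
  For fixed \<open>\<xi>\<close> this places the complex plane in space as a plane containing the
  \<open>x\<^sub>2\<close>-axis; as \<open>\<xi>\<close> runs over the circle, the planes turn about the
  \<open>x\<^sub>2\<close>-axis like the pages of an open book.
\<close>

definition page :: "complex \<Rightarrow> real \<Rightarrow> complex \<Rightarrow> real ^ 3" where
  "page a \<xi> z =
     (let w = exp (2 * of_real pi * \<i> * of_real \<xi>) * of_real (cmod a * (1 + Re (z / a)))
      in vector [Re w, cmod a * Im (z / a), Im w])"

lemma Omega_rep_page: "Omega_rep p s a (\<xi>, x) = page a \<xi> (omega p s (\<xi>, x))"
  by (simp add: Omega_rep_def page_def Let_def)

lemma norm_vec3: "norm (v :: real ^ 3) = sqrt ((v $ 1)\<^sup>2 + (v $ 2)\<^sup>2 + (v $ 3)\<^sup>2)"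
  by (simp add: norm_vec_def L2_set_def sum_3)

lemma page_spin_square:
  "(Re (exp (2 * of_real pi * \<i> * of_real \<xi>) * of_real r))\<^sup>2 +
   (Im (exp (2 * of_real pi * \<i> * of_real \<xi>) * of_real r))\<^sup>2 = r\<^sup>2"
proof -
  have "cmod (exp (2 * of_real pi * \<i> * of_real \<xi>) * of_real r) = \<bar>r\<bar>"
    by (simp add: norm_mult)
  then show ?thesis
    by (metis cmod_power2 power2_abs)
qed

text \<open>
  The axis of the book meets every page in the line of all \<open>z\<close> with \<open>Re (z / a) = - 1\<close>, and
  \<open>z = - a\<close> is the point on the origin of space.
\<close>

lemma norm_page:
  assumes "a \<noteq> 0"
  shows "norm (page a \<xi> z) = cmod (a + z)"
proof -
  have "(norm (page a \<xi> z))\<^sup>2 = (cmod a * (1 + Re (z / a)))\<^sup>2 + (cmod a * Im (z / a))\<^sup>2"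
    using page_spin_square[of \<xi> "cmod a * (1 + Re (z / a))"]
    by (simp add: norm_vec3 page_def Let_def)
  also have "\<dots> = (cmod a)\<^sup>2 * ((1 + Re (z / a))\<^sup>2 + (Im (z / a))\<^sup>2)"
    by (simp add: power_mult_distrib distrib_left[of "(cmod a)\<^sup>2"])
  also have "\<dots> = (cmod a * cmod (1 + z / a))\<^sup>2"
    by (simp add: power_mult_distrib cmod_power2[of "1 + z / a"])
  also have "cmod a * cmod (1 + z / a) = cmod (a + z)"
    using assms by (simp add: norm_mult[symmetric] ring_distribs)
  finally show ?thesis
    by simp
qed

text \<open>
  A page is an affine map whose linear part is \<open>z \<mapsto> page a \<xi> (z - a)\<close>, so the isometry property
  is a norm computation.
\<close>

lemma dist_page:
  assumes "a \<noteq> 0"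
  shows "dist (page a \<xi> z) (page a \<xi> z') = dist z z'"
proof -
  have q: "(z - z' - a) / a = z / a - z' / a - 1"
    using assms by (simp add: diff_divide_distrib)
  have "page a \<xi> z - page a \<xi> z' = page a \<xi> (z - z' - a)"
    unfolding page_def q Let_def by (simp add: vec_eq_iff forall_3 algebra_simps)
  then show ?thesis
    using norm_page[OF assms, of \<xi> "z - z' - a"] by (simp add: dist_norm)
qed


section \<open>First disagreement of digits and the p-adic metric\<close>

lemma padic_first_difference:
  assumes "x \<in> Qp p" "y \<in> Qp p" "x \<noteq> y"
  obtains k where "x k \<noteq> y k" "\<And>m. m < k \<Longrightarrow> x m = y m"
proof -
  obtain N M where N: "\<forall>n<N. x n = 0" and M: "\<forall>n<M. y n = 0"
    using assms by (auto simp: Qp_def)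
  define b where "b = min N M"
  have eq: "x n = y n" if "n < b" for n
    using that N M by (simp add: b_def)
  obtain n where n: "x n \<noteq> y n"
    using assms(3) by blast
  then have "n = b + int (nat (n - b))"
    using eq[of n] by force
  then have ex: "\<exists>d. x (b + int d) \<noteq> y (b + int d)"
    using n by metis
  define d where "d = (LEAST d. x (b + int d) \<noteq> y (b + int d))"
  show thesis
  proof (rule that)
    show "x (b + int d) \<noteq> y (b + int d)"
      unfolding d_def by (rule LeastI_ex[OF ex])
    show "x m = y m" if m: "m < b + int d" for m
    proof (cases "m < b")
      case False
      then have "nat (m - b) < d" "m = b + int (nat (m - b))"
        using m by auto
      moreover from this(1) have "\<not> x (b + int (nat (m - b))) \<noteq> y (b + int (nat (m - b)))"
        unfolding d_def by (rule not_less_Least)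
      ultimately show ?thesis
        by simp
    qed (rule eq)
  qed
qed

lemma padic_zero_Qp: "p > 0 \<Longrightarrow> padic_zero \<in> Qp p"
  by (simp add: Qp_def padic_zero_def)

lemma padic_val_eqI:
  assumes "x k \<noteq> 0" "\<And>m. m < k \<Longrightarrow> x m = 0"
  shows "padic_val x = k"
  unfolding padic_val_def
proof (rule the_equality)
  show "x k \<noteq> 0 \<and> (\<forall>m<k. x m = 0)"
    using assms by blast
  show "n = k" if "x n \<noteq> 0 \<and> (\<forall>m<n. x m = 0)" for n
    using that assms by (metis linorder_neqE)
qed

lemma padic_val_works:
  assumes "x \<in> Qp p" "p > 0" "x \<noteq> padic_zero"
  shows "x (padic_val x) \<noteq> 0" "m < padic_val x \<Longrightarrow> x m = 0"
proof -
  obtain k where k: "x k \<noteq> 0" "\<And>m. m < k \<Longrightarrow> x m = 0"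
    using padic_first_difference[OF assms(1) padic_zero_Qp[OF assms(2)] assms(3)]
    by (metis padic_zero_def)
  then show "x (padic_val x) \<noteq> 0" "m < padic_val x \<Longrightarrow> x m = 0"
    using padic_val_eqI[of x k] by auto
qed

lemma padic_trunc_cong_digits:
  assumes "\<And>k. k \<le> n \<Longrightarrow> x k = y k"
  shows "padic_trunc p x n = padic_trunc p y n"
  unfolding padic_trunc_def using assms by (intro sum.cong) auto

text \<open>
  Subtraction carries from low to high positions, so below the first disagreement the difference
  has zero digits, and at the disagreement its digit is the difference of the two digits modulo
  \<open>p\<close>, which cannot vanish.
\<close>

lemma padic_norm_diff:
  assumes "x \<in> Qp p" "y \<in> Qp p" "p > 1" "x k \<noteq> y k" "\<And>m. m < k \<Longrightarrow> x m = y m"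
  shows "padic_norm p (padic_diff p x y) = real p powi (- k)"
proof -
  let ?d = "padic_diff p x y"
  have below: "?d m = 0" if "m < k" for m
    using padic_trunc_cong_digits[of m x y p] assms(5) that
    by (simp add: padic_diff_def padic_digit_def)
  have "padic_trunc p x k - padic_trunc p y k = real_of_int (x k - y k) * real p powi k"
    using padic_trunc_step[OF assms(1), of k] padic_trunc_step[OF assms(2), of k]
      padic_trunc_cong_digits[of "k - 1" x y p] assms(5) by (simp add: algebra_simps)
  then have "(padic_trunc p x k - padic_trunc p y k) / real p powi k = real_of_int (x k - y k)"
    using assms(3) by simp
  then have d: "?d k = (x k - y k) mod int p"
    by (simp only: padic_diff_def padic_digit_def floor_of_int)
  have "0 \<le> x k" "x k < int p" "0 \<le> y k" "y k < int p"
    using assms(1,2) by (auto simp: Qp_def)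
  then have "\<bar>x k - y k\<bar> < int p"
    by linarith
  then have "\<not> int p dvd x k - y k"
    using assms(4) zdvd_imp_le[of "int p" "\<bar>x k - y k\<bar>"] by auto
  then have top: "?d k \<noteq> 0"
    using d by (simp add: dvd_eq_mod_eq_0)
  then have "?d \<noteq> padic_zero"
    by (auto simp: padic_zero_def)
  then show ?thesis
    using padic_val_eqI[of ?d k, OF top below] by (simp add: padic_norm_def)
qed

lemma padic_diff_self: "padic_diff p x x = padic_zero"
  by (simp add: padic_diff_def padic_zero_def padic_digit_def)

lemma padic_norm_diff_le_1_iff:
  assumes "x \<in> Qp p" "y \<in> Qp p" "p > 1"
  shows "padic_norm p (padic_diff p x y) \<le> 1 \<longleftrightarrow> (\<forall>n<0. x n = y n)"
proof (cases "x = y")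
  case True
  then show ?thesis
    by (simp add: padic_diff_self padic_norm_def)
next
  case False
  then obtain k where k: "x k \<noteq> y k" "\<And>m. m < k \<Longrightarrow> x m = y m"
    using padic_first_difference assms by metis
  have "real p powi (- k) \<le> 1 \<longleftrightarrow> 0 \<le> k"
    using assms(3) power_int_increasing[of "- k" 0 "real p"]
      power_int_strict_increasing[of 0 "- k" "real p"] by (cases "0 \<le> k") auto
  moreover have "0 \<le> k \<longleftrightarrow> (\<forall>n<0. x n = y n)"
    using k by (meson less_le_trans not_less)
  ultimately show ?thesis
    using padic_norm_diff[OF assms k] by simp
qed

text \<open>
  Representatives of two points of the solenoid may be moved by a common integer without changing
  their p-adic distance.
\<close>

lemma padic_diff_translate:
  assumes "x \<in> Qp p" "y \<in> Qp p" "c \<in> Qp p" "p > 1"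
  shows "padic_diff p (padic_add p x c) (padic_add p y c) = padic_diff p x y"
proof (rule padic_eqI[OF _ _ assms(4)])
  have xc: "padic_add p x c \<in> Qp p" and yc: "padic_add p y c \<in> Qp p"
    using padic_add_closed assms by auto
  show "padic_diff p (padic_add p x c) (padic_add p y c) \<in> Qp p" "padic_diff p x y \<in> Qp p"
    using padic_diff_closed xc yc assms by auto
  fix n
  let ?T = "\<lambda>x. padic_trunc p x n"
  have minus: "padic_cong p (n + 1) (- q) (- r)" if "padic_cong p (n + 1) q r" for q r
    using padic_cong_sym[OF that] by (simp add: padic_cong_def)
  have "padic_cong p (n + 1) (?T (padic_add p x c) - ?T (padic_add p y c)) (?T x + ?T c - (?T y + ?T c))"
    using padic_cong_add[OF padic_trunc_add[OF assms(1,3,4)] minus[OF padic_trunc_add[OF assms(2,3,4)]]]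
    by simp
  then have "padic_cong p (n + 1) (?T (padic_diff p (padic_add p x c) (padic_add p y c))) (?T x - ?T y)"
    using padic_cong_trans[OF padic_trunc_diff[OF xc yc assms(4)]] by simp
  then show "padic_cong p (n + 1) (?T (padic_diff p (padic_add p x c) (padic_add p y c)))
      (?T (padic_diff p x y))"
    using padic_cong_trans padic_cong_sym padic_trunc_diff[OF assms(1,2,4)] by metis
qed


section \<open>The characters and the series for \<open>Upsilon\<close>\<close>

lemma norm_chi:
  assumes "x \<in> Qp p" "p > 1"
  shows "cmod (chi p n x) = 1"
proof -
  have "2 * of_real pi * \<i> * of_real t = \<i> * complex_of_real (2 * pi * t)" for t
    by simp
  then show ?thesis
    unfolding chi_eq_trunc[OF assms] by (simp only: norm_exp_i_times)
qed

lemma chi_eq_1: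
  assumes "\<And>k. k \<le> n \<Longrightarrow> x k = 0"
  shows "chi p n x = 1"
proof -
  have "(\<lambda>k. real_of_int (x (n - int k)) * real p powi (- int k)) = (\<lambda>_. 0)"
    using assms by simp
  then show ?thesis
    by (simp add: chi_def)
qed

lemma chi_cong_digits:
  assumes "\<And>k. k \<le> n \<Longrightarrow> x k = y k"
  shows "chi p n x = chi p n y"
proof -
  have "x (n - int k) = y (n - int k)" for k
    using assms by simp
  then show ?thesis
    by (simp add: chi_def)
qed

lemma summable_chi_series:
  assumes "x \<in> Qp p" "p > 1" "0 < cmod s" "cmod s < 1"
  shows "summable (\<lambda>k. s powi (N + int k) * chi p (N + int k) x)"
proof (rule summable_comparison_test')
  show "summable (\<lambda>k. cmod (s powi N) * cmod s ^ k)"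
    using assms(4) by (intro summable_mult summable_geometric) simp
  show "norm (s powi (N + int k) * chi p (N + int k) x) \<le> cmod (s powi N) * cmod s ^ k" for k
    using norm_chi[OF assms(1,2)] assms(3) by (simp add: norm_mult norm_power power_int_add)
qed

text \<open>
  Raising \<open>N\<close> to \<open>v\<close> increases \<open>(1 - s powi N) / (1 - s)\<close> by the sum of \<open>s powi n\<close> over
  \<open>N \<le> n < v\<close>, and these are the terms that the series loses when \<open>v\<close> is the valuation, since
  \<open>chi p n x = 1\<close> there. Hence the valuation in the definition may be replaced by any lower bound
  for the support, which also covers \<open>x = 0\<close> and allows two numbers of different valuation to be
  compared term by term.
\<close>

lemma Upsilon_from:
  assumes x: "x \<in> Qp p" and p: "p > 1" and s: "0 < cmod s" "cmod s < 1"
    and N: "\<And>m. m < N \<Longrightarrow> x m = 0"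
  shows "Upsilon p s x = (1 - s powi N) / (1 - s) + (\<Sum>k. s powi (N + int k) * chi p (N + int k) x)"
proof -
  have s0: "s \<noteq> 0" and s1: "s \<noteq> 1"
    using s by auto
  show ?thesis
  proof (cases "x = padic_zero")
    case True
    then have "(\<Sum>k. s powi (N + int k) * chi p (N + int k) x) = (\<Sum>k. s powi N * s ^ k)"
      using s0 by (simp add: chi_eq_1 padic_zero_def power_int_add)
    also have "\<dots> = s powi N / (1 - s)"
      using s by (simp add: suminf_mult suminf_geometric)
    finally show ?thesis
      using True by (simp add: Upsilon_def add_divide_distrib[symmetric])
  next
    case False
    note v = padic_val_works[OF x _ False]
    define d where "d = nat (padic_val x - N)"
    have "N \<le> padic_val x"
      using v(1) N p by (meson not_less zero_less_one less_trans)
    then have d: "padic_val x = N + int d"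
      by (simp add: d_def)
    let ?f = "\<lambda>k. s powi (N + int k) * chi p (N + int k) x"
    have "suminf ?f = (\<Sum>k. ?f (k + d)) + sum ?f {..<d}"
      using summable_chi_series[OF x p s] by (rule suminf_split_initial_segment)
    moreover have "sum ?f {..<d} = (\<Sum>k<d. s powi N * s ^ k)"
      using v(2) d p s0 by (intro sum.cong refl) (simp add: chi_eq_1 power_int_add)
    moreover have "\<dots> = s powi N * ((1 - s ^ d) / (1 - s))"
      using s1 by (simp add: sum_distrib_left[symmetric] sum_gp_strict)
    moreover have "(\<Sum>k. ?f (k + d)) = (\<Sum>k. s powi (padic_val x + int k) * chi p (padic_val x + int k) x)"
      by (simp add: d ac_simps)
    moreover have "s powi padic_val x = s powi N * s ^ d"
      using s0 by (simp add: d power_int_add)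
    ultimately show ?thesis
      using False by (simp add: Upsilon_def diff_divide_distrib algebra_simps)
  qed
qed


section \<open>Comparing \<open>Upsilon\<close> with the map on the solenoid\<close>

text \<open>
  The real coordinate of \<open>j x\<close> supplies exactly the phase of the digits of \<open>x\<close> at negative
  positions, which are missing from its p-adic coordinate.
\<close>

lemma chi_tilde_j:
  assumes x: "x \<in> Qp p" and p: "p > 1"
  shows "chi_tilde p n (padic_frac p x, padic_int_part x) = chi p (int n) x"
proof -
  let ?y = "padic_int_part x"
  have y: "?y \<in> Qp p"
    using x p by (auto simp: Qp_def padic_int_part_def)
  have "padic_trunc p x (int n) = padic_frac p x + padic_trunc p ?y (int n)"
  proof (induction n)
    case 0
    have "padic_trunc p ?y (- 1) = 0"
      by (rule padic_trunc_eq_0) (simp add: padic_int_part_def)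
    moreover have "padic_trunc p x (- 1) = padic_frac p x"
      unfolding padic_trunc_def padic_frac_def by (rule sum.cong) auto
    ultimately show ?case
      using padic_trunc_step[OF x, of 0] padic_trunc_step[OF y, of 0] by (simp add: padic_int_part_def)
  next
    case (Suc n)
    then show ?case
      using padic_trunc_step[OF x, of "int (Suc n)"] padic_trunc_step[OF y, of "int (Suc n)"]
      by (simp add: padic_int_part_def)
  qed
  moreover have "real p powi (int n + 1) = real p ^ (n + 1)"
    using p by (simp add: power_int_add)
  ultimately show ?thesis
    unfolding chi_tilde_def prod.case chi_eq_trunc[OF x p] chi_eq_trunc[OF y p]
    by (subst exp_add[symmetric]) (simp add: add_divide_distrib ring_distribs)
qed

lemma omega_j:
  assumes "x \<in> Qp p" "p > 1"
  shows "omega p s (padic_frac p x, padic_int_part x) = (\<Sum>n. s ^ n * chi p (int n) x)"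
  by (simp add: omega_def chi_tilde_j[OF assms])

text \<open>
  Stated for the sake of its right-hand side, which depends only on the digits of \<open>x\<close> at negative
  positions: the cluster of \<open>x\<close> is a translate of the image of a fibre under \<open>omega\<close>.
\<close>

lemma Upsilon_minus_omega:
  assumes x: "x \<in> Qp p" and p: "p > 1" and s: "0 < cmod s" "cmod s < 1"
    and d: "\<And>m. m < - int d \<Longrightarrow> x m = 0"
  shows "Upsilon p s x - omega p s (padic_frac p x, padic_int_part x) =
    (1 - s powi (- int d)) / (1 - s) + (\<Sum>k<d. s powi (int k - int d) * chi p (int k - int d) x)"
proof -
  let ?f = "\<lambda>k. s powi (- int d + int k) * chi p (- int d + int k) x"
  have "suminf ?f = (\<Sum>k. ?f (k + d)) + sum ?f {..<d}"
    using summable_chi_series[OF x p s] by (rule suminf_split_initial_segment)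
  moreover have "Upsilon p s x = (1 - s powi (- int d)) / (1 - s) + suminf ?f"
    by (rule Upsilon_from[OF x p s]) (rule d)
  ultimately show ?thesis
    unfolding omega_j[OF x p] by simp
qed

lemma dist_Upsilon_same_frac:
  assumes x: "x \<in> Qp p" and y: "y \<in> Qp p" and p: "p > 1" and s: "0 < cmod s" "cmod s < 1"
    and xy: "\<And>m. m < 0 \<Longrightarrow> x m = y m"
  shows "dist (Upsilon p s x) (Upsilon p s y) =
    dist (omega p s (padic_frac p x, padic_int_part x)) (omega p s (padic_frac p y, padic_int_part y))"
proof -
  obtain N where N: "\<forall>n<N. x n = 0"
    using x by (auto simp: Qp_def)
  define d where "d = nat (- N)"
  have x0: "x m = 0" if "m < - int d" for m
    using that N by (simp add: d_def split: if_splits)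
  moreover have "y m = 0" if "m < - int d" for m
    using that x0[OF that] xy[of m] by simp
  moreover have "chi p (int k - int d) x = chi p (int k - int d) y" if "k < d" for k
    using that xy by (intro chi_cong_digits) auto
  ultimately have "Upsilon p s x - omega p s (padic_frac p x, padic_int_part x) =
      Upsilon p s y - omega p s (padic_frac p y, padic_int_part y)"
    by (simp add: Upsilon_minus_omega[OF x p s, where d = d] Upsilon_minus_omega[OF y p s, where d = d])
  then have "Upsilon p s x - Upsilon p s y =
      omega p s (padic_frac p x, padic_int_part x) - omega p s (padic_frac p y, padic_int_part y)"
    by (simp add: algebra_simps)
  then show ?thesis
    by (simp only: dist_norm)
qed


section \<open>Self-similarity\<close>

text \<open>
  Multiplication by \<open>p ^ k\<close>.
\<close>

definition padic_shift :: "int \<Rightarrow> padic \<Rightarrow> padic" where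
  "padic_shift k x = (\<lambda>n. x (n - k))"

lemma padic_shift_Qp:
  assumes "x \<in> Qp p"
  shows "padic_shift k x \<in> Qp p"
proof -
  obtain N where "\<forall>n<N. x n = 0"
    using assms by (auto simp: Qp_def)
  then have "\<forall>n<N + k. x (n - k) = 0"
    by simp
  then show ?thesis
    using assms by (auto simp: Qp_def padic_shift_def)
qed

text \<open>
  The image of \<open>Upsilon\<close> is self-similar: multiplication by \<open>p\<close> in the p-adic numbers acts on it
  as the contraction \<open>z \<mapsto> s * z + 1\<close>.
\<close>

lemma Upsilon_shift:
  assumes x: "x \<in> Qp p" and p: "p > 1" and s: "0 < cmod s" "cmod s < 1"
  shows "Upsilon p s (padic_shift k x) = s powi k * Upsilon p s x + (1 - s powi k) / (1 - s)"
proof -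
  have s0: "s \<noteq> 0"
    using s by auto
  obtain N where N: "\<And>n. n < N \<Longrightarrow> x n = 0"
    using x by (auto simp: Qp_def)
  have U: "Upsilon p s x = (1 - s powi N) / (1 - s) +
      (\<Sum>j. s powi (N + int j) * chi p (N + int j) x)"
    by (rule Upsilon_from[OF x p s]) (rule N)
  have chi: "chi p (k + n) (padic_shift k x) = chi p n x" for n
    by (simp add: chi_def padic_shift_def algebra_simps)
  have "(\<Sum>j. s powi (k + N + int j) * chi p (k + N + int j) (padic_shift k x)) =
      (\<Sum>j. s powi k * (s powi (N + int j) * chi p (N + int j) x))"
    using s0 by (simp add: add.assoc mult.assoc chi power_int_add)
  also have "\<dots> = s powi k * (\<Sum>j. s powi (N + int j) * chi p (N + int j) x)"
    by (rule suminf_mult[OF summable_chi_series[OF x p s]])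
  finally have sh: "(\<Sum>j. s powi (k + N + int j) * chi p (k + N + int j) (padic_shift k x)) =
      s powi k * (\<Sum>j. s powi (N + int j) * chi p (N + int j) x)" .
  have "Upsilon p s (padic_shift k x) = (1 - s powi (k + N)) / (1 - s) +
      s powi k * (\<Sum>j. s powi (N + int j) * chi p (N + int j) x)"
    unfolding sh[symmetric]
    by (rule Upsilon_from[OF padic_shift_Qp[OF x] p s]) (simp add: padic_shift_def N)
  moreover have "s powi k * ((1 - s powi N) / (1 - s)) + (1 - s powi k) / (1 - s) =
      (1 - s powi (k + N)) / (1 - s)"
    using s0 by (simp add: power_int_add diff_divide_distrib algebra_simps)
  ultimately show ?thesis
    unfolding U by (simp add: ring_distribs)
qed


section \<open>Lipschitz bounds\<close>

text \<open>
  Two representatives in the same sheet are at the p-adic distance of the original points, and in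
  different sheets their real coordinates are at least 1 apart, which is no less than the diameter
  of the p-adic integers.
\<close>

lemma solenoid_dist_fiber_ge:
  assumes x: "x \<in> Zp p" and y: "y \<in> Zp p" and p: "p > 1" and \<alpha>: "0 \<le> \<alpha>"
  shows "padic_norm p (padic_diff p x y) powr \<alpha> \<le>
    solenoid_dist p \<alpha> (solenoid_proj p (\<xi>, x)) (solenoid_proj p (\<xi>, y))"
  unfolding solenoid_dist_def
proof (rule cInf_greatest)
  have xQ: "x \<in> Qp p" and yQ: "y \<in> Qp p"
    using x y by (auto simp: Zp_def)
  let ?D = "padic_norm p (padic_diff p x y) powr \<alpha>"
  have "padic_norm p (padic_diff p x y) \<le> 1"
    using padic_norm_diff_le_1_iff[OF xQ yQ p] x y by (auto simp: Zp_def)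
  moreover have "0 \<le> padic_norm p (padic_diff p x y)"
    by (simp add: padic_norm_def)
  ultimately have D1: "?D \<le> 1"
    using \<alpha> by (intro powr_le1) auto
  show "{max \<bar>\<zeta> - \<eta>\<bar> (padic_norm p (padic_diff p u w) powr \<alpha>) | \<zeta> u \<eta> w.
      (\<zeta>, u) \<in> solenoid_proj p (\<xi>, x) \<and> (\<eta>, w) \<in> solenoid_proj p (\<xi>, y)} \<noteq> {}"
    unfolding solenoid_proj_def by blast
  fix t
  assume "t \<in> {max \<bar>\<zeta> - \<eta>\<bar> (padic_norm p (padic_diff p u w) powr \<alpha>) | \<zeta> u \<eta> w.
      (\<zeta>, u) \<in> solenoid_proj p (\<xi>, x) \<and> (\<eta>, w) \<in> solenoid_proj p (\<xi>, y)}"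
  then obtain n m where t: "t = max \<bar>(\<xi> + real_of_int n) - (\<xi> + real_of_int m)\<bar>
      (padic_norm p (padic_diff p (padic_add p x (padic_of_int p (- n)))
        (padic_add p y (padic_of_int p (- m)))) powr \<alpha>)"
    unfolding solenoid_proj_def by auto
  show "?D \<le> t"
  proof (cases "n = m")
    case True
    have "padic_of_int p (- m) \<in> Qp p"
      using padic_of_int_Zp[OF p] by (simp add: Zp_def)
    then show ?thesis
      using True t padic_diff_translate[OF xQ yQ _ p] by simp
  next
    case False
    then have "1 \<le> \<bar>real_of_int (n - m)\<bar>"
      by linarith
    then show ?thesis
      using t D1 by simp
  qed
qed

text \<open>
  The exponent \<open>1 / Ds p s\<close> is chosen so that the snowflaked p-adic metric scales by \<open>cmod s\<close> under
  multiplication by \<open>p\<close>, at the same rate as the image of \<open>Upsilon\<close>.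
\<close>

lemma padic_norm_powr_Ds:
  assumes "p > 1" "0 < cmod s" "cmod s < 1"
  shows "(real p powi (- k)) powr (1 / Ds p s) = cmod s powi k"
proof -
  have "(real p powi (- k)) powr (1 / Ds p s) = (real p powr real_of_int (- k)) powr (- log (real p) (cmod s))"
    using assms(1) powr_real_of_int'[of "real p" "- k"] by (simp add: Ds_def)
  also have "\<dots> = (real p powr log (real p) (cmod s)) powr real_of_int k"
    by (simp add: powr_powr mult.commute)
  also have "\<dots> = cmod s powi k"
    using assms by (simp add: powr_real_of_int')
  finally show ?thesis .
qed

lemma Omega_proj_page:
  assumes "x \<in> Zp p" "p > 1"
  shows "Omega p s a (solenoid_proj p (\<xi>, x)) = page a \<xi> (omega p s (\<xi>, x))"
  by (simp add: Omega_solenoid_proj[OF assms] Omega_rep_page)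

lemma padic_int_part_Zp: "x \<in> Qp p \<Longrightarrow> padic_int_part x \<in> Zp p"
  by (auto simp: Qp_def Zp_def padic_int_part_def)

lemma Omega_j:
  assumes "x \<in> Qp p" "p > 1"
  shows "Omega p s a (solenoid_j p x) =
    page a (padic_frac p x) (omega p s (padic_frac p x, padic_int_part x))"
  unfolding solenoid_j_def by (rule Omega_proj_page[OF padic_int_part_Zp[OF assms(1)] assms(2)])

lemma padic_frac_cong: "(\<And>m. m < 0 \<Longrightarrow> x m = y m) \<Longrightarrow> padic_frac p x = padic_frac p y"
  unfolding padic_frac_def by (rule sum.cong) auto

lemma dist_Omega_j_same_frac:
  assumes x: "x \<in> Qp p" and y: "y \<in> Qp p" and p: "p > 1" and s: "0 < cmod s" "cmod s < 1"
    and a: "a \<noteq> 0" and xy: "\<And>m. m < 0 \<Longrightarrow> x m = y m"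
  shows "dist (Omega p s a (solenoid_j p x)) (Omega p s a (solenoid_j p y)) =
    dist (Upsilon p s x) (Upsilon p s y)"
proof -
  have "padic_frac p x = padic_frac p y"
    by (rule padic_frac_cong) (rule xy)
  moreover have "dist (Upsilon p s x) (Upsilon p s y) =
      dist (omega p s (padic_frac p x, padic_int_part x)) (omega p s (padic_frac p y, padic_int_part y))"
    by (rule dist_Upsilon_same_frac[OF x y p s]) (rule xy)
  ultimately show ?thesis
    by (simp add: Omega_j[OF x p] Omega_j[OF y p] dist_page[OF a])
qed

lemma norm_Omega_j_le:
  assumes x: "x \<in> Qp p" and p: "p > 1" and s: "cmod s < 1" and a: "a \<noteq> 0"
  shows "norm (Omega p s a (solenoid_j p x)) \<le> cmod a + 1 / (1 - cmod s)"
proof -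
  have "cmod (\<Sum>n. s ^ n * chi p (int n) x) \<le> (\<Sum>n. cmod s ^ n)"
    using s norm_chi[OF x p] by (intro norm_suminf_le) (simp_all add: norm_mult norm_power)
  also have "\<dots> = 1 / (1 - cmod s)"
    using s by (simp add: suminf_geometric)
  finally have "cmod (a + (\<Sum>n. s ^ n * chi p (int n) x)) \<le> cmod a + 1 / (1 - cmod s)"
    by (intro order_trans[OF norm_triangle_ineq]) simp
  then show ?thesis
    by (simp add: Omega_j[OF x p] norm_page[OF a] omega_j[OF x p])
qed

text \<open>
  The lower Lipschitz bound of \<open>Omega\<close> on the fibre over 0 is one for \<open>Upsilon\<close> on the p-adic
  integers, with respect to the metric \<open>cmod s powi k\<close>, where \<open>k\<close> is the first position of
  disagreement. Both sides of it scale by the same factor under multiplication by powers of \<open>p\<close>,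
  so it holds on all p-adic numbers with the same constant.
\<close>

lemma Upsilon_separates:
  assumes p: "p > 1" and s: "0 < cmod s" "cmod s < 1" and a: "a \<noteq> 0"
    and C: "\<And>f g. f \<in> solenoid p \<Longrightarrow> g \<in> solenoid p \<Longrightarrow>
      solenoid_dist p (1 / Ds p s) f g \<le> C * dist (Omega p s a f) (Omega p s a g)"
    and x: "x \<in> Qp p" and y: "y \<in> Qp p" and k: "x k \<noteq> y k" "\<And>m. m < k \<Longrightarrow> x m = y m"
  shows "cmod s powi k \<le> C * dist (Upsilon p s x) (Upsilon p s y)"
proof -
  obtain N M where N: "\<forall>n<N. x n = 0" and M: "\<forall>n<M. y n = 0"
    using x y by (auto simp: Qp_def)
  \<comment> \<open>The common shift that moves both numbers into the p-adic integers.\<close>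
  define r where "r = - min N M"
  let ?x = "padic_shift r x" and ?y = "padic_shift r y"
  have xQ: "?x \<in> Qp p" and yQ: "?y \<in> Qp p"
    using padic_shift_Qp x y by auto
  moreover have "?x m = 0" "?y m = 0" if "m < 0" for m
    using that N M by (simp_all add: padic_shift_def r_def)
  ultimately have xZ: "?x \<in> Zp p" and yZ: "?y \<in> Zp p"
    by (simp_all add: Zp_def)
  have "?x (r + k) \<noteq> ?y (r + k)" "\<And>m. m < r + k \<Longrightarrow> ?x m = ?y m"
    using k by (simp_all add: padic_shift_def)
  from padic_norm_diff[OF xQ yQ p this]
  have norm: "padic_norm p (padic_diff p ?x ?y) = real p powi (- (r + k))" .
  have int_part: "padic_frac p z = 0" "padic_int_part z = z" if "z \<in> Zp p" for z
    using that by (auto simp: Zp_def padic_frac_def padic_int_part_def intro!: sum.neutral)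
  have j: "solenoid_j p z = solenoid_proj p (0, z)" if "z \<in> Zp p" for z
    using int_part[OF that] by (simp add: solenoid_j_def)
  have "log (real p) (cmod s) \<le> 0"
    using p s by simp
  then have "0 \<le> 1 / Ds p s"
    by (simp add: Ds_def)
  then have "cmod s powi (r + k) \<le> solenoid_dist p (1 / Ds p s) (solenoid_j p ?x) (solenoid_j p ?y)"
    using solenoid_dist_fiber_ge[OF xZ yZ p, of "1 / Ds p s" 0]
    by (simp only: norm padic_norm_powr_Ds[OF p s] j xZ yZ)
  also have "\<dots> \<le> C * dist (Omega p s a (solenoid_j p ?x)) (Omega p s a (solenoid_j p ?y))"
    using xZ yZ by (intro C) (auto simp: j solenoid_def)
  also have "\<dots> = C * dist (Upsilon p s ?x) (Upsilon p s ?y)"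
    using xZ yZ by (subst dist_Omega_j_same_frac[OF xQ yQ p s a]) (auto simp: Zp_def)
  also have "dist (Upsilon p s ?x) (Upsilon p s ?y) = cmod s powi r * dist (Upsilon p s x) (Upsilon p s y)"
    unfolding Upsilon_shift[OF x p s] Upsilon_shift[OF y p s]
    by (simp add: dist_norm norm_mult norm_power_int right_diff_distrib[symmetric])
  finally have "cmod s powi r * cmod s powi k \<le> cmod s powi r * (C * dist (Upsilon p s x) (Upsilon p s y))"
    using s by (simp add: power_int_add ac_simps)
  then show ?thesis
    using s by simp
qed

text \<open>
  Within a cluster the two distances agree. Points of different clusters have images under
  \<open>Upsilon\<close> at least \<open>1 / C\<close> apart, because they disagree at a negative position, while the
  image of \<open>Omega\<close> is bounded.
\<close>

lemma Omega_j_Lipschitz_in_Upsilon: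
  assumes p: "p > 1" and s: "0 < cmod s" "cmod s < 1" and a: "a \<noteq> 0"
    and C: "\<And>f g. f \<in> solenoid p \<Longrightarrow> g \<in> solenoid p \<Longrightarrow>
      solenoid_dist p (1 / Ds p s) f g \<le> C * dist (Omega p s a f) (Omega p s a g)"
    and x: "x \<in> Qp p" and y: "y \<in> Qp p"
  shows "dist (Omega p s a (solenoid_j p x)) (Omega p s a (solenoid_j p y)) \<le>
    max 1 (2 * (cmod a + 1 / (1 - cmod s)) * C) * dist (Upsilon p s x) (Upsilon p s y)"
proof (cases "\<forall>m<0. x m = y m")
  case True
  have "1 * dist (Upsilon p s x) (Upsilon p s y) \<le>
      max 1 (2 * (cmod a + 1 / (1 - cmod s)) * C) * dist (Upsilon p s x) (Upsilon p s y)"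
    by (intro mult_right_mono) auto
  then show ?thesis
    using True by (simp add: dist_Omega_j_same_frac[OF x y p s a])
next
  case False
  let ?B = "cmod a + 1 / (1 - cmod s)"
  let ?d = "dist (Upsilon p s x) (Upsilon p s y)"
  have "x \<noteq> y"
    using False by auto
  then obtain k where k: "x k \<noteq> y k" "\<And>m. m < k \<Longrightarrow> x m = y m"
    using padic_first_difference[OF x y] by metis
  then have "k < 0"
    using False by (meson less_le_trans not_less)
  then obtain n where n: "k = - int n"
    using nonpos_int_cases[of k] by auto
  have "1 \<le> cmod s powi k"
    using s by (simp add: n power_int_minus one_le_inverse_iff power_le_one)
  also have "\<dots> \<le> C * ?d"
    by (rule Upsilon_separates[OF p s a C x y k])
  finally have sep: "1 \<le> C * ?d" .
  have "dist (Omega p s a (solenoid_j p x)) (Omega p s a (solenoid_j p y)) \<le> 2 * ?B"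
    using norm_Omega_j_le[OF x p s(2) a] norm_Omega_j_le[OF y p s(2) a]
      norm_triangle_ineq4[of "Omega p s a (solenoid_j p x)" "Omega p s a (solenoid_j p y)"]
    by (simp add: dist_norm)
  also have "\<dots> \<le> 2 * ?B * (C * ?d)"
    using mult_left_mono[OF sep, of "2 * ?B"] s by simp
  also have "\<dots> = (2 * ?B * C) * ?d"
    by (simp only: mult.assoc)
  also have "\<dots> \<le> max 1 (2 * ?B * C) * ?d"
    by (intro mult_right_mono) auto
  finally show ?thesis .
qed


section \<open>The map \<open>J\<close>\<close>

text \<open>
  The digits at negative positions determine the real coordinate of \<open>j x\<close>, and those at
  nonnegative positions are free and make up the p-adic coordinate.
\<close>

lemma solenoid_fiber_eq:
  assumes l: "l \<in> Qp p"
  shows "solenoid_fiber p (padic_frac p l) = solenoid_j p ` {x \<in> Qp p. \<forall>m<0. x m = l m}"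
proof (intro equalityI subsetI)
  fix f assume "f \<in> solenoid_fiber p (padic_frac p l)"
  then obtain y where y: "y \<in> Zp p" and f: "f = solenoid_proj p (padic_frac p l, y)"
    by (auto simp: solenoid_fiber_def)
  define x where "x = (\<lambda>n. if n < 0 then l n else y n)"
  have frac: "padic_frac p x = padic_frac p l"
    by (rule padic_frac_cong) (simp add: x_def)
  have int_part: "padic_int_part x = y"
    using y by (auto simp: padic_int_part_def x_def Zp_def)
  obtain N where "\<forall>n<N. l n = 0"
    using l by (auto simp: Qp_def)
  then have "\<forall>n<min N 0. x n = 0"
    by (simp add: x_def)
  then have "\<exists>N. \<forall>n<N. x n = 0"
    by blast
  moreover have "0 \<le> x n \<and> x n < int p" for n
    using l y by (simp add: x_def Qp_def Zp_def)
  ultimately have "x \<in> Qp p"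
    unfolding Qp_def by blast
  with frac int_part show "f \<in> solenoid_j p ` {x \<in> Qp p. \<forall>m<0. x m = l m}"
    by (intro image_eqI[of _ _ x]) (simp_all add: f solenoid_j_def x_def)
next
  fix f assume "f \<in> solenoid_j p ` {x \<in> Qp p. \<forall>m<0. x m = l m}"
  then obtain x where x: "x \<in> Qp p" "\<forall>m<0. x m = l m" "f = solenoid_j p x"
    by blast
  then have "padic_frac p x = padic_frac p l"
    by (intro padic_frac_cong) auto
  then show "f \<in> solenoid_fiber p (padic_frac p l)"
    using x padic_int_part_Zp by (auto simp: solenoid_fiber_def solenoid_j_def)
qed

theorem mainTheorem9:
  fixes p :: nat and s a :: complex
  assumes "prime p"
    and "0 < cmod s" and "cmod s < 1"
    and "a \<noteq> 0"
    and "L_isometry_on (solenoid p) (solenoid_dist p (1 / Ds p s)) dist (Omega p s a)"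
  shows "\<exists>J :: complex \<Rightarrow> real ^ 3.
    L_contraction_on UNIV dist dist J \<and>
    (\<forall>l \<in> Qp p.
       (\<forall>z \<in> cluster p s l. \<forall>w \<in> cluster p s l. dist (J z) (J w) = dist z w) \<and>
       J ` cluster p s l = Omega p s a ` solenoid_fiber p (padic_frac p l)) \<and>
    (\<forall>x \<in> Qp p. Omega p s a (solenoid_j p x) = J (Upsilon p s x))"
proof -
  have p: "p > 1"
    using assms(1) by (rule prime_gt_1_nat)
  note s = assms(2,3) and a = assms(4)
  let ?F = "\<lambda>x. Omega p s a (solenoid_j p x)" and ?U = "Upsilon p s"
  obtain C where C: "\<And>f g. f \<in> solenoid p \<Longrightarrow> g \<in> solenoid p \<Longrightarrow>
      solenoid_dist p (1 / Ds p s) f g \<le> C * dist (Omega p s a f) (Omega p s a g)"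
    using assms(5) unfolding L_isometry_on_def by blast
  define L where "L = max 1 (2 * (cmod a + 1 / (1 - cmod s)) * C)"
  have lip: "dist (?F x) (?F y) \<le> L * dist (?U x) (?U y)" if "x \<in> Qp p" "y \<in> Qp p" for x y
    unfolding L_def by (rule Omega_j_Lipschitz_in_Upsilon[OF p s a C that])
  define J\<^sub>0 where "J\<^sub>0 z = ?F (inv_into (Qp p) ?U z)" for z
  \<comment> \<open>The choice of the preimage does not matter: by \<open>lip\<close>, points with equal images under \<open>?U\<close>
     have equal images under \<open>?F\<close>.\<close>
  have J\<^sub>0: "J\<^sub>0 (?U x) = ?F x" if "x \<in> Qp p" for x
  proof -
    have "inv_into (Qp p) ?U (?U x) \<in> Qp p" "?U (inv_into (Qp p) ?U (?U x)) = ?U x"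
      using that by (auto intro: inv_into_into f_inv_into_f[of "?U x" ?U])
    then show ?thesis
      using lip[of "inv_into (Qp p) ?U (?U x)" x] that by (simp add: J\<^sub>0_def)
  qed
  have "\<exists>J. (\<forall>z\<in>?U ` Qp p. J z = J\<^sub>0 z) \<and>
      (\<forall>z w. dist (J z) (J w) \<le> real CARD(3) * L * dist z w)"
  proof (rule lipschitz_extension_cart)
    show "0 \<le> L"
      by (simp add: L_def)
    show "dist (J\<^sub>0 z) (J\<^sub>0 w) \<le> L * dist z w" if "z \<in> ?U ` Qp p" "w \<in> ?U ` Qp p" for z w
      using that lip by (auto simp: J\<^sub>0)
  qed
  then obtain J where J: "\<And>z. z \<in> ?U ` Qp p \<Longrightarrow> J z = J\<^sub>0 z"
      and J_lip: "\<And>z w. dist (J z) (J w) \<le> real CARD(3) * L * dist z w"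
    by blast
  have J_U: "J (?U x) = ?F x" if "x \<in> Qp p" for x
    using that J J\<^sub>0 by simp
  have "(\<forall>z \<in> cluster p s l. \<forall>w \<in> cluster p s l. dist (J z) (J w) = dist z w) \<and>
      J ` cluster p s l = Omega p s a ` solenoid_fiber p (padic_frac p l)" if l: "l \<in> Qp p" for l
  proof -
    let ?X = "{x \<in> Qp p. \<forall>m<0. x m = l m}"
    have X: "cluster p s l = ?U ` ?X"
      using padic_norm_diff_le_1_iff[OF _ l p] by (auto simp: cluster_def)
    have "dist (J (?U x)) (J (?U y)) = dist (?U x) (?U y)" if "x \<in> ?X" "y \<in> ?X" for x y
      using that dist_Omega_j_same_frac[OF _ _ p s a, of x y] by (simp add: J_U)
    moreover have "J ` cluster p s l = ?F ` ?X"
      unfolding X image_image by (rule image_cong) (auto simp: J_U)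
    ultimately show ?thesis
      unfolding solenoid_fiber_eq[OF l] by (auto simp: X image_image)
  qed
  then show ?thesis
    using J_lip J_U unfolding L_contraction_on_def by (intro exI[of _ J]) auto
qed

end
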